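(* Let $(\mathcal M,\cdot)$ be a group such that the real linear space $\mathcal H=\operatorname{Hom}((\mathcal M,\cdot),(\mathbb R,+))$ of group homomorphisms into the additive reals is finite-dimensional, endowed with the standard Euclidean topology. Let $J\colon\mathcal M\to\mathcal H^*$, $J(x)=\delta_x$, where $\delta_x(\varphi)=\varphi(x)$ for $\varphi\in\mathcal H$. Then $$\operatorname{supcl}(\mathcal H)=\{f\circ J: f\in\operatorname{supcl}(\mathcal H^{**})\}=\{f\circ J: f\colon\mathcal H^*\to\mathbb R\cup\{+\infty\}\text{ is convex and lower semi-continuous}\}\cup\{-\infty\},$$ where $-\infty$ denotes the constant function and $\mathcal H^{**}$ is regarded as the set of linear real-valued functions on $\mathcal H^*$.
   Context: $\mathcal H^*$ and $\mathcal H^{**}$ are the dual and bidual spaces of the finite-dimensional space $\mathcal H$. For a non-empty set $S$ and a set $\mathcal F$ of functions $S\to\mathbb R\cup\{+\infty,-\infty\}$, put $\widetilde{\mathcal F}:=\{\varphi+c:\varphi\in\mathcal F,\ c\in\mathbb R\}$. The $\mathcal F$-regularization of $f\colon S\to\mathbb R\cup\{+\infty,-\infty\}$ is $\operatorname{reg}_{\mathcal F}(f)(x):=\sup\{\varphi(x):\varphi\in\widetilde{\mathcal F},\ \varphi\le f\}$, $x\in S$ (pointwise order, $\sup\emptyset=-\infty$), and the sup-closure of $\mathcal F$ is $\operatorname{supcl}(\mathcal F):=\{\operatorname{reg}_{\mathcal F}(f): f\colon S\to\mathbb R\cup\{+\infty,-\infty\}\}$. Here $\operatorname{supcl}(\mathcal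 H)$ is taken with $S=\mathcal M$ and $\operatorname{supcl}(\mathcal H^{**})$ with $S=\mathcal H^*$. Convex functions are allowed to be identically $+\infty$. *)

theory Defs
  imports "HOL-Analysis.Analysis"
begin

section \<open>Regularization and sup-closure\<close>

text \<open>The set \<open>S\<close> of the definition is the whole type \<open>'s\<close>, hence automatically non-empty.
  In \<^typ>\<open>ereal\<close> the supremum of the empty set is \<open>-\<infinity>\<close>, and the order on functions is pointwise.\<close>

definition const_shifts :: "('s \<Rightarrow> ereal) set \<Rightarrow> ('s \<Rightarrow> ereal) set" where
  "const_shifts F = {\<lambda>x. \<phi> x + ereal c | \<phi> c. \<phi> \<in> F}"

definition regularization :: "('s \<Rightarrow> ereal) set \<Rightarrow> ('s \<Rightarrow> ereal) \<Rightarrow> 's \<Rightarrow> ereal" where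
  "regularization F f x = Sup {\<phi> x | \<phi>. \<phi> \<in> const_shifts F \<and> \<phi> \<le> f}"

definition supcl :: "('s \<Rightarrow> ereal) set \<Rightarrow> ('s \<Rightarrow> ereal) set" where
  "supcl F = range (regularization F)"


section \<open>The space of real homomorphisms of a group\<close>

text \<open>The class \<^class>\<open>group_add\<close> does not assume commutativity; the group operation
  is merely written \<open>+\<close>.\<close>

typedef (overloaded) 'm real_hom =
  "{\<phi> :: 'm::group_add \<Rightarrow> real. \<forall>x y. \<phi> (x + y) = \<phi> x + \<phi> y}"
  morphisms hom_fun Abs_real_hom
  by (rule exI[of _ "\<lambda>_. 0"]) simp

setup_lifting type_definition_real_hom

instantiation real_hom :: (group_add) real_vector
begin

lift_definition zero_real_hom :: "'a real_hom" is "\<lambda>_. 0" by simp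
lift_definition plus_real_hom :: "'a real_hom \<Rightarrow> 'a real_hom \<Rightarrow> 'a real_hom"
  is "\<lambda>\<phi> \<psi> x. \<phi> x + \<psi> x" by simp
lift_definition minus_real_hom :: "'a real_hom \<Rightarrow> 'a real_hom \<Rightarrow> 'a real_hom"
  is "\<lambda>\<phi> \<psi> x. \<phi> x - \<psi> x" by simp
lift_definition uminus_real_hom :: "'a real_hom \<Rightarrow> 'a real_hom"
  is "\<lambda>\<phi> x. - \<phi> x" by simp
lift_definition scaleR_real_hom :: "real \<Rightarrow> 'a real_hom \<Rightarrow> 'a real_hom"
  is "\<lambda>c \<phi> x. c * \<phi> x" by (simp add: algebra_simps)

instance
  by standard (transfer; simp add: algebra_simps fun_eq_iff)+

end


section \<open>Algebraic dual\<close>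

typedef (overloaded) 'v dual_space = "{L :: 'v::real_vector \<Rightarrow> real. linear L}"
  morphisms dual_fun Abs_dual_space
  by (rule exI[of _ "\<lambda>_. 0"]) (simp add: linear_iff)

setup_lifting type_definition_dual_space

instantiation dual_space :: (real_vector) real_vector
begin

lift_definition zero_dual_space :: "'a dual_space" is "\<lambda>_. 0"
  by (simp add: linear_iff)
lift_definition plus_dual_space :: "'a dual_space \<Rightarrow> 'a dual_space \<Rightarrow> 'a dual_space"
  is "\<lambda>K L v. K v + L v" by (simp add: linear_iff algebra_simps)
lift_definition minus_dual_space :: "'a dual_space \<Rightarrow> 'a dual_space \<Rightarrow> 'a dual_space"
  is "\<lambda>K L v. K v - L v" by (simp add: linear_iff algebra_simps)
lift_definition uminus_dual_space :: "'a dual_space \<Rightarrow> 'a dual_space"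
  is "\<lambda>L v. - L v" by (simp add: linear_iff)
lift_definition scaleR_dual_space :: "real \<Rightarrow> 'a dual_space \<Rightarrow> 'a dual_space"
  is "\<lambda>c L v. c * L v" by (simp add: linear_iff algebra_simps)

instance
  by standard (transfer; simp add: algebra_simps fun_eq_iff)+

end

lift_definition eval_at :: "'m::group_add \<Rightarrow> 'm real_hom dual_space" is "\<lambda>x \<phi>. hom_fun \<phi> x"
  by (simp add: linear_iff plus_real_hom.rep_eq scaleR_real_hom.rep_eq)

definition hom_functions :: "('m::group_add \<Rightarrow> ereal) set" where
  "hom_functions = range (\<lambda>\<phi> x. ereal (hom_fun \<phi> x))"

definition bidual_functions :: "('v::real_vector dual_space \<Rightarrow> ereal) set" where
  "bidual_functions = range (\<lambda>(\<Phi> :: 'v dual_space dual_space) L. ereal (dual_fun \<Phi> L))"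


section \<open>Euclidean topology of a finite-dimensional real vector space\<close>

definition finite_dimensional :: "'v::real_vector itself \<Rightarrow> bool" where
  "finite_dimensional _ \<longleftrightarrow> (\<exists>B :: 'v set. finite B \<and> span B = UNIV)"

text \<open>The topology transported from \<open>\<real>\<^sup>B\<close> along the coordinate isomorphism of a basis \<open>B\<close>.\<close>

definition coordinate_topology :: "'v::real_vector set \<Rightarrow> 'v topology" where
  "coordinate_topology B =
     pullback_topology UNIV (\<lambda>v. restrict (representation B v) B) (powertop_real B)"

text \<open>Here \<open>extend_basis {}\<close> is some basis of the space; by \<open>euclidean_topology_eq\<close> below
  the choice is irrelevant in finite dimension.\<close>

definition euclidean_topology :: "'v::real_vector topology" where
  "euclidean_topology = coordinate_topology (extend_basis {})"

lemma topspace_coordinate_topology [simp]: "topspace (coordinate_topology B) = UNIV"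
  by (auto simp: coordinate_topology_def topspace_pullback_topology)

lemma continuous_map_coordinate_topology:
  assumes "finite B" "independent B" "span B = UNIV" "independent C" "span C = UNIV"
  shows "continuous_map (coordinate_topology B) (coordinate_topology C) id"
proof -
  have coord: "continuous_map (coordinate_topology B) euclideanreal (\<lambda>v. representation B v b)"
    if "b \<in> B" for b
  proof -
    have "continuous_map (coordinate_topology B) euclideanreal
        ((\<lambda>g. g b) \<circ> (\<lambda>v. restrict (representation B v) B))"
      unfolding coordinate_topology_def
      by (intro continuous_map_pullback continuous_map_product_projection that)
    then show ?thesis using that by (simp add: o_def)
  qed
  have eq: "representation C v c = (\<Sum>b\<in>B. representation B v b * representation C b c)" for v c
  proof -
    have "v = (\<Sum>b\<in>B. representation B v b *\<^sub>R b)"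
      using sum_representation_eq[of B v B] assms by auto
    then have "representation C v c = representation C (\<Sum>b\<in>B. representation B v b *\<^sub>R b) c"
      by simp
    also have "\<dots> = (\<Sum>b\<in>B. representation C (representation B v b *\<^sub>R b) c)"
      using assms by (simp add: representation_sum)
    also have "\<dots> = (\<Sum>b\<in>B. representation B v b * representation C b c)"
      using assms by (simp add: representation_scale)
    finally show ?thesis .
  qed
  have "continuous_map (coordinate_topology B) euclideanreal
      (\<lambda>v. \<Sum>b\<in>B. representation B v b * representation C b c)" for c
    using \<open>finite B\<close>
    by (intro continuous_map_sum continuous_map_real_mult_right coord)
  then have "continuous_map (coordinate_topology B) euclideanreal (\<lambda>v. representation C v c)" for c
    by (subst eq)
  then have "continuous_map (coordinate_topology B) (powertop_real C)
      ((\<lambda>v. restrict (representation C v) C) \<circ> id)"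
    by (auto simp: continuous_map_componentwise)
  then show ?thesis
    unfolding coordinate_topology_def[of C] by (rule continuous_map_pullback') simp
qed

lemma euclidean_topology_eq:
  fixes B :: "'v::real_vector set"
  assumes "finite B" "independent B" "span B = UNIV"
  shows "euclidean_topology = coordinate_topology B"
proof -
  let ?E = "extend_basis {} :: 'v set"
  have E: "independent ?E" "span ?E = UNIV"
    by (simp_all add: independent_extend_basis span_extend_basis independent_empty)
  have "finite ?E"
    using independent_span_bound[of B ?E] assms E by simp
  then have "homeomorphic_maps (coordinate_topology ?E) (coordinate_topology B) id id"
    using E assms by (simp add: homeomorphic_maps_def continuous_map_coordinate_topology)
  then show ?thesis
    by (simp add: euclidean_topology_def homeomorphic_maps_id)
qed


section \<open>Convexity and lower semi-continuity of extended real functions\<close>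

text \<open>Only used for functions that avoid \<open>-\<infinity>\<close>, so that no sum \<open>\<infinity> + (-\<infinity>)\<close> occurs;
  \<open>0 * \<infinity> = 0\<close> in \<^typ>\<open>ereal\<close>.\<close>

definition convex_ereal :: "('v::real_vector \<Rightarrow> ereal) \<Rightarrow> bool" where
  "convex_ereal f \<longleftrightarrow>
     (\<forall>x y. \<forall>u\<ge>0. \<forall>v\<ge>0. u + v = 1 \<longrightarrow>
        f (u *\<^sub>R x + v *\<^sub>R y) \<le> ereal u * f x + ereal v * f y)"

definition lower_semicontinuous :: "'s topology \<Rightarrow> ('s \<Rightarrow> ereal) \<Rightarrow> bool" where
  "lower_semicontinuous T f \<longleftrightarrow>
     (\<forall>x\<in>topspace T. \<forall>a. a < f x \<longrightarrow> (\<exists>U. openin T U \<and> x \<in> U \<and> (\<forall>y\<in>U. a < f y)))"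

end

theory Submission
  imports Defs
begin

text \<open>Precomposition with \<open>J\<close> maps \<open>\<H>\<^sup>*\<^sup>*\<close> onto \<open>\<H>\<close> and commutes with pointwise suprema, which gives
  the first equality. For the second one, let \<open>f\<close> be convex, lower semi-continuous and not constantly
  \<open>\<infinity>\<close>, and let \<open>a < f x\<^sub>0\<close>. On a large ball around \<open>x\<^sub>0\<close> the function \<open>f + k |\<cdot> - x\<^sub>0|\<^sup>2\<close> attains
  its minimum, for large \<open>k\<close> in the interior of the ball. The first-order condition at the minimizer
  is an affine minorant of \<open>f\<close>, and its value at \<open>x\<^sub>0\<close> is at least \<open>a\<close> for large \<open>k\<close>. No hyperplane
  separating a point from the epigraph, which could be vertical, is needed.\<close>

section \<open>Sup-closures\<close>

text \<open>A supremum of a family \<open>A\<close> of shifts is its own regularization, because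
  every member of \<open>A\<close> lies below it. Working with families replaces the arbitrary
  function being regularized; the empty family yields \<open>-\<infinity>\<close>.\<close>

lemma supcl_eq_SUP: "supcl F = {\<lambda>x. SUP \<phi>\<in>A. \<phi> x | A. A \<subseteq> const_shifts F}"
proof (intro equalityI subsetI)
  fix g assume "g \<in> supcl F"
  then obtain f where g: "g = regularization F f"
    by (auto simp: supcl_def)
  have "g = (\<lambda>x. SUP \<phi>\<in>{\<phi> \<in> const_shifts F. \<phi> \<le> f}. \<phi> x)"
    unfolding g regularization_def by (intro ext arg_cong[where f = Sup]) auto
  then show "g \<in> {\<lambda>x. SUP \<phi>\<in>A. \<phi> x | A. A \<subseteq> const_shifts F}"
    by blast
next
  fix g assume "g \<in> {\<lambda>x. SUP \<phi>\<in>A. \<phi> x | A. A \<subseteq> const_shifts F}"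
  then obtain A where A: "A \<subseteq> const_shifts F" and g: "g = (\<lambda>x. SUP \<phi>\<in>A. \<phi> x)"
    by blast
  have "regularization F g x = g x" for x
  proof (rule antisym)
    show "regularization F g x \<le> g x"
      unfolding regularization_def by (rule Sup_least) (auto simp: le_fun_def)
    show "g x \<le> regularization F g x"
      unfolding regularization_def g using A
      by (intro SUP_least Sup_upper) (auto simp: le_fun_def intro: SUP_upper)
  qed
  then show "g \<in> supcl F"
    unfolding supcl_def by (metis ext rangeI)
qed

lemma const_shifts_comp: "const_shifts ((\<lambda>\<psi>. \<psi> \<circ> j) ` G) = (\<lambda>\<psi>. \<psi> \<circ> j) ` const_shifts G"
proof -
  have shifts: "const_shifts F = (\<Union>\<phi>\<in>F. range (\<lambda>c x. \<phi> x + ereal c))" for F :: "('x \<Rightarrow> ereal) set"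
    by (auto simp: const_shifts_def)
  show ?thesis
    unfolding shifts by (simp add: image_UN image_image o_def)
qed

text \<open>Pointwise suprema and constant shifts both commute with precomposition by
  \<open>j\<close>, so a family in the image lifts to a family in \<open>const_shifts G\<close>, and
  families push forward in the same way.\<close>

lemma supcl_comp: "supcl ((\<lambda>\<psi>. \<psi> \<circ> j) ` G) = {f \<circ> j | f. f \<in> supcl G}"
  unfolding supcl_eq_SUP const_shifts_comp
proof (intro equalityI subsetI; clarsimp)
  fix A assume "A \<subseteq> (\<lambda>\<psi>. \<psi> \<circ> j) ` const_shifts G"
  then obtain B where "B \<subseteq> const_shifts G" "A = (\<lambda>\<psi>. \<psi> \<circ> j) ` B"
    by (auto simp: subset_image_iff)
  then show "\<exists>f. (\<lambda>x. SUP \<phi>\<in>A. \<phi> x) = f \<circ> j \<and> (\<exists>A. f = (\<lambda>x. SUP \<phi>\<in>A. \<phi> x) \<and> A \<subseteq> const_shifts G)"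
    by (intro exI[of _ "\<lambda>x. SUP \<phi>\<in>B. \<phi> x"]) (auto simp: fun_eq_iff image_image)
next
  fix A assume "A \<subseteq> const_shifts G"
  then show "\<exists>B. (\<lambda>x. SUP \<phi>\<in>A. \<phi> x) \<circ> j = (\<lambda>x. SUP \<phi>\<in>B. \<phi> x) \<and> B \<subseteq> (\<lambda>\<psi>. \<psi> \<circ> j) ` const_shifts G"
    by (intro exI[of _ "(\<lambda>\<psi>. \<psi> \<circ> j) ` A"]) (auto simp: fun_eq_iff image_image)
qed

lemma bottom_in_supcl: "(\<lambda>_. -\<infinity>) \<in> supcl F"
  unfolding supcl_eq_SUP by (auto intro!: exI[of _ "{}"] simp: bot_ereal_def)

section \<open>Homomorphisms as bidual functionals composed with \<open>J\<close>\<close>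

text \<open>A homomorphism \<open>\<phi>\<close> is \<open>J\<close> followed by evaluation of
  functionals at \<open>\<phi>\<close>. Conversely, \<open>eval_at\<close> is additive, so a linear
  functional composed with it is a homomorphism.\<close>

lemma hom_functions_eq:
  "(hom_functions :: ('m::group_add \<Rightarrow> ereal) set) = (\<lambda>\<psi>. \<psi> \<circ> eval_at) ` bidual_functions"
proof (intro equalityI subsetI)
  fix g :: "'m \<Rightarrow> ereal" assume "g \<in> hom_functions"
  then obtain \<phi> where g: "g = (\<lambda>x. ereal (hom_fun \<phi> x))"
    by (auto simp: hom_functions_def)
  define \<Phi> where "\<Phi> = Abs_dual_space (\<lambda>L. dual_fun L \<phi>)"
  have "dual_fun \<Phi> = (\<lambda>L. dual_fun L \<phi>)"
    unfolding \<Phi>_def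
    by (rule Abs_dual_space_inverse)
      (simp add: linear_iff plus_dual_space.rep_eq scaleR_dual_space.rep_eq)
  then have "g = (\<lambda>L. ereal (dual_fun \<Phi> L)) \<circ> eval_at"
    by (simp add: g fun_eq_iff eval_at.rep_eq)
  then show "g \<in> (\<lambda>\<psi>. \<psi> \<circ> eval_at) ` bidual_functions"
    by (auto simp: bidual_functions_def)
next
  fix g :: "'m \<Rightarrow> ereal" assume "g \<in> (\<lambda>\<psi>. \<psi> \<circ> eval_at) ` bidual_functions"
  then obtain \<Phi> where g: "g = (\<lambda>x. ereal (dual_fun \<Phi> (eval_at x)))"
    by (auto simp: bidual_functions_def o_def)
  define \<phi> :: "'m real_hom" where "\<phi> = Abs_real_hom (\<lambda>x. dual_fun \<Phi> (eval_at x))"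
  have add: "eval_at (x + y) = eval_at x + eval_at y" for x y :: 'm
  proof transfer
    fix x y :: 'm
    have "hom_fun \<phi> (x + y) = hom_fun \<phi> x + hom_fun \<phi> y" for \<phi> :: "'m real_hom"
      using hom_fun[of \<phi>] by simp
    then show "(\<lambda>\<phi>. hom_fun \<phi> (x + y)) = (\<lambda>\<phi>. hom_fun \<phi> x + hom_fun \<phi> y)"
      by simp
  qed
  have "hom_fun \<phi> = (\<lambda>x. dual_fun \<Phi> (eval_at x))"
    unfolding \<phi>_def using dual_fun[of \<Phi>]
    by (intro Abs_real_hom_inverse) (simp add: add linear_iff)
  then show "g \<in> hom_functions"
    unfolding hom_functions_def by (intro image_eqI[of _ _ \<phi>]) (simp_all add: g)
qed

section \<open>Coordinates in finite-dimensional spaces\<close>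

lemma finite_dimensional_basis:
  assumes "finite_dimensional TYPE('v::real_vector)"
  obtains B :: "'v::real_vector set" where "finite B" "independent B" "span B = UNIV"
proof -
  obtain S :: "'v set" where S: "finite S" "span S = UNIV"
    using assms by (auto simp: finite_dimensional_def)
  obtain B where "B \<subseteq> S" "independent B" "span B = span S"
    using maximal_independent_subset[of S] by (metis span_eq span_superset subset_trans)
  then show ?thesis
    using that S finite_subset by metis
qed

text \<open>The coordinate functionals \<open>d b\<close> of a finite basis span the dual:
  \<open>L\<close> is the combination of the \<open>d b\<close> with coefficients
  \<open>L b\<close>.\<close>

lemma finite_dimensional_dual:
  assumes "finite_dimensional TYPE('v::real_vector)"
  shows "finite_dimensional TYPE('v dual_space)"
proof -
  obtain B :: "'v set" where B: "finite B" "independent B" "span B = UNIV"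
    using finite_dimensional_basis[OF assms] .
  define d where "d b = Abs_dual_space (\<lambda>v. representation B v b)" for b
  have d: "dual_fun (d b) v = representation B v b" for b v
    unfolding d_def using B
    by (subst Abs_dual_space_inverse) (auto simp: linear_iff representation_add representation_scale)
  have sum: "dual_fun (\<Sum>b\<in>A. c b *\<^sub>R d b) v = (\<Sum>b\<in>A. c b * dual_fun (d b) v)"
    if "finite A" for A c v
    using that by (induction A) (auto simp: zero_dual_space.rep_eq plus_dual_space.rep_eq
        scaleR_dual_space.rep_eq)
  have "L \<in> span (d ` B)" for L
  proof -
    have lin: "linear (dual_fun L)"
      using dual_fun[of L] by simp
    have "dual_fun L v = dual_fun (\<Sum>b\<in>B. dual_fun L b *\<^sub>R d b) v" for v
    proof -
      have "dual_fun L v = dual_fun L (\<Sum>b\<in>B. representation B v b *\<^sub>R b)"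
        using sum_representation_eq[of B v B] B by simp
      also have "\<dots> = (\<Sum>b\<in>B. dual_fun L b * representation B v b)"
        by (simp add: linear_sum[OF lin] linear_scale[OF lin] mult.commute)
      finally show ?thesis
        by (simp add: sum B d)
    qed
    then have "L = (\<Sum>b\<in>B. dual_fun L b *\<^sub>R d b)"
      by (intro dual_fun_inject[THEN iffD1] ext)
    also have "\<dots> \<in> span (d ` B)"
      by (intro span_sum span_scale span_base) auto
    finally show ?thesis .
  qed
  then show ?thesis
    unfolding finite_dimensional_def using B by (intro exI[of _ "d ` B"]) auto
qed

lemma continuous_map_representation:
  "continuous_map (coordinate_topology B) euclideanreal (\<lambda>v. representation B v b)"
proof (cases "b \<in> B")
  case True
  have "continuous_map (coordinate_topology B) euclideanreal
      ((\<lambda>g. g b) \<circ> (\<lambda>v. restrict (representation B v) B))"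
    unfolding coordinate_topology_def
    by (intro continuous_map_pullback continuous_map_product_projection True)
  then show ?thesis using True by (simp add: o_def)
next
  case False
  then have "representation B v b = 0" for v
    using representation_ne_zero by blast
  then show ?thesis by simp
qed

lemma continuous_map_linear:
  fixes l :: "'v::real_vector \<Rightarrow> real"
  assumes B: "finite B" "independent B" "span B = UNIV" and l: "linear l"
  shows "continuous_map (coordinate_topology B) euclideanreal l"
proof -
  have "l v = (\<Sum>b\<in>B. representation B v b * l b)" for v
  proof -
    have "l v = l (\<Sum>b\<in>B. representation B v b *\<^sub>R b)"
      using sum_representation_eq[of B v B] B by simp
    then show ?thesis
      by (simp add: linear_sum[OF l] linear_scale[OF l])
  qed
  then have "l = (\<lambda>v. \<Sum>b\<in>B. representation B v b * l b)"
    by (rule ext)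
  moreover have "continuous_map (coordinate_topology B) euclideanreal
      (\<lambda>v. \<Sum>b\<in>B. representation B v b * l b)"
    using B by (intro continuous_map_sum continuous_map_real_mult_right continuous_map_representation)
  ultimately show ?thesis by (rule ssubst[of _ _ "continuous_map (coordinate_topology B) euclideanreal"])
qed

text \<open>The box is the image of a product of compact intervals, compact by Tychonoff, under the
  inverse \<open>?j\<close> of the coordinate map.\<close>

lemma compactin_coordinate_box:
  fixes B :: "'v::real_vector set"
  assumes B: "finite B" "independent B" "span B = UNIV"
  shows "compactin (coordinate_topology B) {v. \<forall>b\<in>B. representation B v b \<in> {l b..u b}}"
proof -
  let ?j = "\<lambda>g. \<Sum>b\<in>B. g b *\<^sub>R b"
  have rep: "representation B (?j g) b = g b" if "b \<in> B" for g b
  proof -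
    have "representation B (?j g) b = (\<Sum>c\<in>B. g c * representation B c b)"
      using B by (simp add: representation_sum representation_scale)
    also have "\<dots> = (\<Sum>c\<in>B. if c = b then g b else 0)"
      using B that by (intro sum.cong) (auto simp: representation_basis)
    finally show ?thesis using B that by simp
  qed
  \<comment> \<open>A map into a pullback topology is continuous once its composition with the
    coordinate map is; here that composition is the identity.\<close>
  have "continuous_map (powertop_real B) (powertop_real B)
      ((\<lambda>v. restrict (representation B v) B) \<circ> ?j)"
    by (rule continuous_map_eq[OF continuous_map_id]) (auto simp: rep fun_eq_iff PiE_def extensional_def)
  then have "continuous_map (powertop_real B) (coordinate_topology B) ?j"
    unfolding coordinate_topology_def by (rule continuous_map_pullback') simp
  moreover have "compactin (powertop_real B) (\<Pi>\<^sub>E b\<in>B. {l b..u b})"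
    by (simp add: compactin_PiE)
  ultimately have "compactin (coordinate_topology B) (?j ` (\<Pi>\<^sub>E b\<in>B. {l b..u b}))"
    by (rule image_compactin[rotated])
  also have "?j ` (\<Pi>\<^sub>E b\<in>B. {l b..u b}) = {v. \<forall>b\<in>B. representation B v b \<in> {l b..u b}}"
  proof (intro equalityI subsetI)
    fix v assume v: "v \<in> {v. \<forall>b\<in>B. representation B v b \<in> {l b..u b}}"
    have "v = ?j (restrict (representation B v) B)"
      using sum_representation_eq[of B v B] B by simp
    moreover have "restrict (representation B v) B \<in> (\<Pi>\<^sub>E b\<in>B. {l b..u b})"
      using v by simp
    ultimately show "v \<in> ?j ` (\<Pi>\<^sub>E b\<in>B. {l b..u b})"
      by (intro image_eqI[of _ ?j "restrict (representation B v) B"])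
  qed (auto simp: rep PiE_def Pi_def)
  finally show ?thesis .
qed

section \<open>Inner product and balls in coordinates\<close>

text \<open>For a finite basis \<open>B\<close> this is the inner product that makes
  \<open>B\<close> orthonormal; it provides the quadratic penalty.\<close>

definition coord_inner :: "'v::real_vector set \<Rightarrow> 'v \<Rightarrow> 'v \<Rightarrow> real" where
  "coord_inner B v w = (\<Sum>b\<in>B. representation B v b * representation B w b)"

lemma linear_coord_inner:
  assumes "independent B" "span B = UNIV"
  shows "linear (coord_inner B v)"
  using assms by (simp add: linear_iff coord_inner_def representation_add representation_scale
      algebra_simps sum.distrib sum_distrib_left)

lemma coord_inner_add_scaleR:
  assumes "independent B" "span B = UNIV"
  shows "coord_inner B (v + t *\<^sub>R w) (v + t *\<^sub>R w) =
    coord_inner B v v + 2 * t * coord_inner B v w + t\<^sup>2 * coord_inner B w w"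
  using assms by (simp add: coord_inner_def representation_add representation_scale
      algebra_simps power2_eq_square sum.distrib sum_distrib_left)

lemma coord_inner_nonneg: "0 \<le> coord_inner B v v"
  unfolding coord_inner_def by (intro sum_nonneg) simp

lemma coord_inner_pos:
  assumes B: "finite B" "independent B" "span B = UNIV" and "v \<noteq> 0"
  shows "0 < coord_inner B v v"
proof -
  have "coord_inner B v v \<noteq> 0"
  proof
    assume "coord_inner B v v = 0"
    then have "\<forall>b\<in>B. representation B v b = 0"
      using B by (simp add: coord_inner_def sum_nonneg_eq_0_iff)
    then have "(\<Sum>b\<in>B. representation B v b *\<^sub>R b) = 0"
      by simp
    then show False
      using sum_representation_eq[of B v B] B \<open>v \<noteq> 0\<close> by simp
  qed
  then show ?thesis
    using coord_inner_nonneg[of B v] by linarith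
qed

lemma continuous_map_coord_inner_diff:
  assumes "finite B" "independent B" "span B = UNIV"
  shows "continuous_map (coordinate_topology B) euclideanreal (\<lambda>v. coord_inner B (v - x) (v - x))"
  using assms by (simp add: coord_inner_def representation_diff)
    (intro continuous_map_sum continuous_map_real_mult continuous_map_diff
      continuous_map_representation; simp)

text \<open>Each squared coordinate of \<open>v - x\<close> is one summand of
  \<open>coord_inner\<close>, so the ball is a closed subset of a box with half-widths
  \<open>sqrt r\<close>.\<close>

lemma compactin_coord_ball:
  assumes B: "finite B" "independent B" "span B = UNIV" and "0 \<le> r"
  shows "compactin (coordinate_topology B) {v. coord_inner B (v - x) (v - x) \<le> r}"
proof -
  let ?K = "{v. coord_inner B (v - x) (v - x) \<le> r}"
  let ?r = "\<lambda>b. representation B x b"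
  have "closedin (coordinate_topology B)
      {v \<in> topspace (coordinate_topology B). coord_inner B (v - x) (v - x) \<in> {..r}}"
    by (rule closedin_continuous_map_preimage[OF continuous_map_coord_inner_diff[OF B]]) simp
  then have "closedin (coordinate_topology B) ?K"
    by simp
  moreover have "?K \<subseteq> {v. \<forall>b\<in>B. representation B v b \<in> {?r b - sqrt r..?r b + sqrt r}}"
  proof clarify
    fix v b assume v: "coord_inner B (v - x) (v - x) \<le> r" and b: "b \<in> B"
    have "(representation B (v - x) b)\<^sup>2 \<le> coord_inner B (v - x) (v - x)"
      unfolding coord_inner_def power2_eq_square using B b
      by (intro member_le_sum) auto
    with v have "(representation B v b - ?r b)\<^sup>2 \<le> r"
      using B by (simp add: representation_diff)
    then have "\<bar>representation B v b - ?r b\<bar> \<le> sqrt r"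
      by (simp add: real_le_rsqrt real_sqrt_abs[symmetric] del: real_sqrt_abs)
    then show "representation B v b \<in> {?r b - sqrt r..?r b + sqrt r}"
      by (auto simp: abs_le_iff)
  qed
  ultimately show ?thesis
    by (intro closed_compactin[OF compactin_coordinate_box[OF B]])
qed

section \<open>Lower semi-continuous functions\<close>

lemma lower_semicontinuous_add_continuous:
  assumes f: "lower_semicontinuous T f" and h: "continuous_map T euclideanreal h"
  shows "lower_semicontinuous T (\<lambda>x. f x + ereal (h x))"
  unfolding lower_semicontinuous_def
proof (intro ballI allI impI)
  fix x a assume x: "x \<in> topspace T" and a: "a < f x + ereal (h x)"
  then have "a - ereal (h x) < f x"
    by (cases a; cases "f x") auto
  \<comment> \<open>The gap between \<open>a\<close> and \<open>f x + h x\<close> is split: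
    \<open>f\<close> stays above \<open>c\<close> on \<open>U\<close>, and \<open>h\<close> stays
    above \<open>h x - e\<close> on \<open>?V\<close>. A real \<open>c\<close> also covers
    \<open>f x = \<infinity>\<close>; for \<open>a = -\<infinity>\<close> any positive
    \<open>e\<close> works.\<close>
  then obtain c where c: "a - ereal (h x) < ereal c" "ereal c < f x"
    using ereal_dense2 by blast
  obtain e :: real where e: "e > 0" "a < ereal (c + h x - e)"
  proof (cases a)
    case (real s)
    with c have "s < c + h x" by simp
    with real show ?thesis
      by (intro that[of "(c + h x - s) / 2"]) (auto simp: field_simps)
  qed (use c in \<open>auto intro: that[of 1]\<close>)
  obtain U where U: "openin T U" "x \<in> U" "\<forall>y\<in>U. ereal c < f y"
    using f x c unfolding lower_semicontinuous_def by meson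
  let ?V = "{y \<in> topspace T. h y \<in> {h x - e<..}}"
  have "openin T ?V"
    by (rule openin_continuous_map_preimage[OF h]) simp
  then have "openin T (U \<inter> ?V)" "x \<in> U \<inter> ?V"
    using U x e by auto
  moreover have "a < f y + ereal (h y)" if "y \<in> U \<inter> ?V" for y
  proof -
    have "ereal c < f y" "ereal (h x - e) < ereal (h y)"
      using that U by auto
    then have "ereal (c + h x - e) < f y + ereal (h y)"
      by (cases "f y") auto
    with e show ?thesis by (auto intro: less_trans)
  qed
  ultimately show "\<exists>U. openin T U \<and> x \<in> U \<and> (\<forall>y\<in>U. a < f y + ereal (h y))"
    by blast
qed

lemma lower_semicontinuous_SUP:
  assumes "\<And>f. f \<in> A \<Longrightarrow> lower_semicontinuous T f"
  shows "lower_semicontinuous T (\<lambda>x. SUP f\<in>A. f x)"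
  unfolding lower_semicontinuous_def
proof (intro ballI allI impI)
  fix x a assume x: "x \<in> topspace T" and "a < (SUP f\<in>A. f x)"
  then obtain f where f: "f \<in> A" "a < f x"
    by (auto simp: less_SUP_iff)
  then obtain U where "openin T U" "x \<in> U" "\<forall>y\<in>U. a < f y"
    using assms x unfolding lower_semicontinuous_def by meson
  with f show "\<exists>U. openin T U \<and> x \<in> U \<and> (\<forall>y\<in>U. a < (SUP f\<in>A. f y))"
    by (auto simp: less_SUP_iff)
qed

lemma lower_semicontinuous_continuous:
  assumes "continuous_map T euclideanreal h"
  shows "lower_semicontinuous T (\<lambda>x. ereal (h x))"
proof -
  have "lower_semicontinuous T (\<lambda>x. 0)"
    unfolding lower_semicontinuous_def by (metis openin_topspace)
  from lower_semicontinuous_add_continuous[OF this assms] show ?thesis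
    by simp
qed

text \<open>Without a minimizer, every \<open>x\<close> has some \<open>p x\<close> in
  \<open>K\<close> with a smaller value, and the neighbourhoods where \<open>f\<close> exceeds
  \<open>f (p x)\<close> cover \<open>K\<close>. In a finite subcover, choose \<open>z\<close> with
  \<open>f (p z)\<close> least; the set \<open>U w\<close> containing \<open>p z\<close> then gives
  \<open>f (p w) < f (p z)\<close>, a contradiction.\<close>

lemma lower_semicontinuous_attains_inf:
  assumes f: "lower_semicontinuous T f" and K: "compactin T K" "K \<noteq> {}"
  obtains x where "x \<in> K" "\<And>y. y \<in> K \<Longrightarrow> f x \<le> f y"
proof (rule ccontr)
  assume "\<not> thesis"
  then have "\<forall>x\<in>K. \<exists>y\<in>K. f y < f x"
    using that by (meson not_le)
  then obtain p where p: "\<And>x. x \<in> K \<Longrightarrow> p x \<in> K \<and> f (p x) < f x"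
    by metis
  have "\<forall>x\<in>K. \<exists>U. openin T U \<and> x \<in> U \<and> (\<forall>y\<in>U. f (p x) < f y)"
    using p f compactin_subset_topspace[OF K(1)] unfolding lower_semicontinuous_def by blast
  then obtain U where U: "\<And>x. x \<in> K \<Longrightarrow> openin T (U x) \<and> x \<in> U x \<and> (\<forall>y\<in>U x. f (p x) < f y)"
    by metis
  then have "\<exists>\<F>. finite \<F> \<and> \<F> \<subseteq> U ` K \<and> K \<subseteq> \<Union>\<F>"
    using K(1) by (intro compactinD) auto
  then obtain D where D: "finite D" "D \<subseteq> K" "K \<subseteq> \<Union>(U ` D)"
    by (metis finite_subset_image)
  with K(2) have "D \<noteq> {}" by auto
  with D(1) have "Min ((\<lambda>x. f (p x)) ` D) \<in> (\<lambda>x. f (p x)) ` D"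
    by (intro Min_in) auto
  then obtain z where z: "z \<in> D" "f (p z) = Min ((\<lambda>x. f (p x)) ` D)"
    by (metis imageE)
  obtain w where w: "w \<in> D" "p z \<in> U w"
    using D p z by blast
  then have "f (p w) < f (p z)"
    using U D by blast
  moreover have "f (p z) \<le> f (p w)"
    using z w D by simp
  ultimately show False by simp
qed

section \<open>Affine minorants of convex functions\<close>

text \<open>Here \<open>a\<close> is any real below \<open>f x0\<close>, and
  \<open>f x0 = \<infinity>\<close> is allowed, so the affine minorants of \<open>f\<close> have
  supremum \<open>f x0\<close> at \<open>x0\<close>.\<close>

lemma affine_minorant_at:
  fixes f :: "'v::real_vector \<Rightarrow> ereal"
  assumes B: "finite B" "independent B" "span B = UNIV"
    and proper: "\<And>v. f v \<noteq> -\<infinity>" and cvx: "convex_ereal f"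
    and lsc: "lower_semicontinuous (coordinate_topology B) f" and a: "ereal a < f x0"
  obtains l c where "linear l" "\<And>z. ereal (l z + c) \<le> f z" "a \<le> l x0 + c"
proof (cases "\<exists>y. f y \<noteq> \<infinity>")
  case False
  then show ?thesis
    by (intro that[of "\<lambda>_. 0" a]) (auto simp: linear_iff)
next
  case True
  then obtain y0 F0 where F0: "f y0 = ereal F0"
    using proper by (metis ereal_cases)
  define q where "q v = coord_inner B (v - x0) (v - x0)" for v
  \<comment> \<open>The ball contains the point \<open>y0\<close> of finite value, with a margin of
    1 that later keeps the minimizer off the boundary.\<close>
  define r where "r = q y0 + 1"
  define K where "K = {v. q v \<le> r}"
  have q_nonneg: "0 \<le> q v" for v
    unfolding q_def by (rule coord_inner_nonneg)
  have q_cont: "continuous_map (coordinate_topology B) euclideanreal q"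
    unfolding q_def by (rule continuous_map_coord_inner_diff[OF B])
  have K: "compactin (coordinate_topology B) K" and y0: "y0 \<in> K"
    unfolding K_def using q_nonneg[of y0] B
    by (auto simp: r_def q_def intro!: compactin_coord_ball)
  obtain ym where ym: "ym \<in> K" "\<And>v. v \<in> K \<Longrightarrow> f ym \<le> f v"
    using lower_semicontinuous_attains_inf[OF lsc K] y0 by blast
  then obtain m where m: "f ym = ereal m"
    using ym(2)[OF y0] F0 proper by (metis ereal_cases ereal_infty_less_eq(1) PInfty_neq_ereal(1))
  obtain U where U: "openin (coordinate_topology B) U" "x0 \<in> U" "\<forall>y\<in>U. ereal a < f y"
    using lsc a unfolding lower_semicontinuous_def by (metis UNIV_I topspace_coordinate_topology)
  have KU: "compactin (coordinate_topology B) (K - U)"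
  proof -
    have "closedin (coordinate_topology B) (topspace (coordinate_topology B) - U)"
      using U by blast
    then have "compactin (coordinate_topology B) (K \<inter> (UNIV - U))"
      using K by (simp add: compact_Int_closedin)
    then show ?thesis by (simp add: Diff_eq)
  qed
  \<comment> \<open>On \<open>U\<close> the values of \<open>f\<close> exceed \<open>a\<close>; on
    the rest of the ball the penalty \<open>q\<close> is bounded away from 0, since
    \<open>x0\<close> lies in \<open>U\<close>.\<close>
  obtain \<delta> where \<delta>: "\<delta> > 0" "\<And>v. v \<in> K - U \<Longrightarrow> \<delta> \<le> q v"
  proof (cases "K - U = {}")
    case True
    then show ?thesis by (intro that[of 1]) auto
  next
    case False
    obtain z where z: "z \<in> K - U" "\<And>y. y \<in> K - U \<Longrightarrow> ereal (q z) \<le> ereal (q y)"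
      using lower_semicontinuous_attains_inf[OF lower_semicontinuous_continuous[OF q_cont] KU False]
      by blast
    have "0 < q z"
      unfolding q_def using z U by (intro coord_inner_pos[OF B]) auto
    with z show ?thesis by (intro that[of "q z"]) auto
  qed
  \<comment> \<open>The first summand makes the penalty outside \<open>U\<close> lift the minimum
    \<open>m\<close> to at least \<open>a\<close>; the other two give \<open>k > F0 - m\<close>,
    which forces the minimizer into the interior.\<close>
  define k where "k = \<bar>a - m\<bar> / \<delta> + \<bar>F0 - m\<bar> + 1"
  have "0 \<le> \<bar>a - m\<bar> / \<delta>"
    using \<delta> by simp
  then have "k > 0" "k \<ge> \<bar>a - m\<bar> / \<delta>" and k2: "k > F0 - m"
    unfolding k_def by linarith+
  then have k1: "m + k * \<delta> \<ge> a"
    using \<delta>(1) by (simp add: pos_divide_le_eq)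
  have "lower_semicontinuous (coordinate_topology B) (\<lambda>v. f v + ereal (k * q v))"
    by (intro lower_semicontinuous_add_continuous lsc continuous_map_real_mult_left q_cont)
  then obtain y where y: "y \<in> K" "\<And>v. v \<in> K \<Longrightarrow> f y + ereal (k * q y) \<le> f v + ereal (k * q v)"
    using lower_semicontinuous_attains_inf[OF _ K] y0 by blast
  then obtain F where F: "f y = ereal F"
    using y(2)[OF y0] F0 proper[of y] by (cases "f y") auto
  have "m \<le> F"
    using ym(2)[OF y(1)] m F by simp
  \<comment> \<open>From \<open>q y \<ge> q y0 + 1\<close>, comparison with \<open>y0\<close> would
    give \<open>k \<le> F0 - F \<le> F0 - m\<close>.\<close>
  have interior: "q y < r"
  proof (rule ccontr)
    assume "\<not> q y < r"
    then have "k * r \<le> k * q y"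
      using \<open>k > 0\<close> by simp
    moreover have "F + k * q y \<le> F0 + k * q y0"
      using y(2)[OF y0] F F0 by simp
    ultimately show False
      using k2 \<open>m \<le> F\<close> by (simp add: r_def algebra_simps)
  qed
  \<comment> \<open>The slope is minus the gradient of \<open>k * q\<close> at
    \<open>y\<close>.\<close>
  define l where "l z = - 2 * k * coord_inner B (y - x0) z" for z
  have l: "linear l"
    unfolding l_def using linear_coord_inner[OF B(2,3), of "y - x0"]
    by (simp add: linear_iff algebra_simps)
  have minorant: "ereal (l z + (F - l y)) \<le> f z" for z
  proof (cases "f z")
    case (real Fz)
    \<comment> \<open>By convexity, \<open>t * D t\<close> bounds from above the increase of the
      penalized function from \<open>y\<close> to \<open>y + t *\<^sub>R (z - y)\<close>;
      \<open>Q t\<close> is the value of \<open>q\<close> at that point.\<close>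
    define D where "D t = Fz - F + k * (2 * coord_inner B (y - x0) (z - y)
      + t * coord_inner B (z - y) (z - y))" for t
    define Q where "Q t = q y + 2 * t * coord_inner B (y - x0) (z - y)
      + t\<^sup>2 * coord_inner B (z - y) (z - y)" for t
    have qt: "q (y + t *\<^sub>R (z - y)) = Q t" for t
      using coord_inner_add_scaleR[OF B(2,3), of "y - x0" t "z - y"]
      by (simp add: q_def Q_def algebra_simps)
    \<comment> \<open>Since \<open>Q 0 = q y < r\<close>, the segment from \<open>y\<close> towards
      \<open>z\<close> starts inside the ball, where minimality of \<open>y\<close> applies, even if
      \<open>z\<close> lies outside.\<close>
    have "(Q \<longlongrightarrow> Q 0) (at_right 0)"
      unfolding Q_def by (intro tendsto_intros)
    then have "eventually (\<lambda>t. Q t < r) (at_right 0)"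
      using interior by (intro order_tendstoD(2)[of Q "Q 0"]) (simp_all add: Q_def[of 0])
    moreover have "eventually (\<lambda>t::real. 0 < t \<and> t < 1) (at_right 0)"
      by (auto simp: eventually_at_right_field intro!: exI[of _ 1])
    ultimately have "eventually (\<lambda>t. 0 \<le> D t) (at_right 0)"
    proof eventually_elim
      case (elim t)
      let ?v = "y + t *\<^sub>R (z - y)"
      have "f ?v = f ((1 - t) *\<^sub>R y + t *\<^sub>R z)"
        by (simp add: algebra_simps)
      also have "\<dots> \<le> ereal (1 - t) * f y + ereal t * f z"
        using cvx elim unfolding convex_ereal_def by simp
      finally have "f ?v \<le> ereal ((1 - t) * F + t * Fz)"
        by (simp add: F real)
      moreover have "?v \<in> K"
        using elim by (simp add: K_def qt)
      from y(2)[OF this] have "ereal (F + k * q y) \<le> f ?v + ereal (k * Q t)"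
        by (simp add: F qt)
      ultimately have "ereal (F + k * q y) \<le> ereal ((1 - t) * F + t * Fz) + ereal (k * Q t)"
        by (meson add_right_mono order_trans)
      then have "0 \<le> t * D t"
        by (simp add: Q_def D_def algebra_simps power2_eq_square)
      then show ?case
        using elim by (simp add: zero_le_mult_iff)
    qed
    moreover have "(D \<longlongrightarrow> D 0) (at_right 0)"
      unfolding D_def by (intro tendsto_intros)
    \<comment> \<open>The limit is the first-order condition: \<open>D 0\<close> equals
      \<open>Fz - F - (l z - l y)\<close>.\<close>
    ultimately have "0 \<le> D 0"
      by (intro tendsto_lowerbound[of D "D 0" "at_right 0"]) auto
    then show ?thesis
      using linear_diff[OF linear_coord_inner[OF B(2,3)], of "y - x0" z y]
      by (simp add: D_def l_def real algebra_simps)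
  qed (use proper in auto)
  \<comment> \<open>Either \<open>y\<close> lies in \<open>U\<close>, where already
    \<open>F > a\<close>, or \<open>q y \<ge> \<delta>\<close> and the choice of \<open>k\<close>
    applies.\<close>
  have "a \<le> F + k * q y"
  proof (cases "y \<in> U")
    case True
    then show ?thesis
      using U(3) F mult_nonneg_nonneg[OF less_imp_le[OF \<open>k > 0\<close>] q_nonneg[of y]] by force
  next
    case False
    then have "k * \<delta> \<le> k * q y"
      using \<delta>(2)[of y] y(1) \<open>k > 0\<close> by simp
    then show ?thesis
      using k1 \<open>m \<le> F\<close> by linarith
  qed
  \<comment> \<open>The doubled penalty is the exact value of the minorant at \<open>x0\<close>,
    because \<open>l x0 - l y = 2 * k * q y\<close>.\<close>
  also have "\<dots> \<le> F + 2 * (k * q y)"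
    using q_nonneg[of y] \<open>k > 0\<close> by simp
  also have "q y = coord_inner B (y - x0) y - coord_inner B (y - x0) x0"
    unfolding q_def by (rule linear_diff[OF linear_coord_inner[OF B(2,3)]])
  also have "F + 2 * (k * (coord_inner B (y - x0) y - coord_inner B (y - x0) x0)) = l x0 + (F - l y)"
    by (simp add: l_def algebra_simps)
  finally show ?thesis
    using that[OF l minorant] by blast
qed

section \<open>Suprema of affine functions on the dual space\<close>

lemma convex_ereal_SUP:
  assumes A: "\<And>f. f \<in> A \<Longrightarrow> convex_ereal f"
  shows "convex_ereal (\<lambda>x. SUP f\<in>A. f x)"
  unfolding convex_ereal_def
proof (intro allI impI SUP_least)
  fix x y f and u v :: real
  assume uv: "0 \<le> u" "0 \<le> v" "u + v = 1" and f: "f \<in> A"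
  have "f (u *\<^sub>R x + v *\<^sub>R y) \<le> ereal u * f x + ereal v * f y"
    using A[OF f] uv by (simp add: convex_ereal_def)
  also have "\<dots> \<le> ereal u * (SUP f\<in>A. f x) + ereal v * (SUP f\<in>A. f y)"
    using uv f by (intro add_mono ereal_mult_left_mono SUP_upper) auto
  finally show "f (u *\<^sub>R x + v *\<^sub>R y) \<le> ereal u * (SUP f\<in>A. f x) + ereal v * (SUP f\<in>A. f y)" .
qed

lemma const_shifts_bidual_functions:
  "const_shifts (bidual_functions :: ('v::real_vector dual_space \<Rightarrow> ereal) set) =
    {\<lambda>L. ereal (l L + c) | l c. linear l}"
proof (intro equalityI subsetI)
  fix g :: "'v dual_space \<Rightarrow> ereal" assume "g \<in> {\<lambda>L. ereal (l L + c) | l c. linear l}"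
  then obtain l c where l: "linear l" and g: "g = (\<lambda>L. ereal (l L + c))"
    by blast
  then have "g = (\<lambda>L. ereal (dual_fun (Abs_dual_space l) L) + ereal c)"
    by (simp add: Abs_dual_space_inverse)
  then show "g \<in> const_shifts bidual_functions"
    unfolding const_shifts_def bidual_functions_def
    by (intro CollectI exI[of _ "\<lambda>L. ereal (dual_fun (Abs_dual_space l) L)"] exI[of _ c] conjI rangeI)
next
  fix g :: "'v dual_space \<Rightarrow> ereal" assume "g \<in> const_shifts bidual_functions"
  then obtain \<Phi> c where "g = (\<lambda>L. ereal (dual_fun \<Phi> L + c))"
    by (auto simp: const_shifts_def bidual_functions_def)
  then show "g \<in> {\<lambda>L. ereal (l L + c) | l c. linear l}"
    using dual_fun[of \<Phi>] by blast
qed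

text \<open>Suprema of nonempty families of affine functions avoid \<open>-\<infinity>\<close> and
  inherit convexity and lower semi-continuity; the empty family accounts for the extra constant.
  Conversely, \<open>affine_minorant_at\<close> recovers \<open>f\<close> as the supremum of its
  affine minorants.\<close>

lemma supcl_bidual_functions:
  assumes "finite_dimensional TYPE('v::real_vector dual_space)"
  shows "supcl (bidual_functions :: ('v dual_space \<Rightarrow> ereal) set) =
    {f. (\<forall>L. f L \<noteq> -\<infinity>) \<and> convex_ereal f \<and> lower_semicontinuous euclidean_topology f} \<union> {\<lambda>_. -\<infinity>}"
proof -
  obtain B :: "'v dual_space set" where B: "finite B" "independent B" "span B = UNIV"
    using finite_dimensional_basis[OF assms] .
  note top = euclidean_topology_eq[OF B]
  show ?thesis
  proof (intro equalityI subsetI)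
    fix g assume "g \<in> supcl (bidual_functions :: ('v dual_space \<Rightarrow> ereal) set)"
    then obtain A where A: "A \<subseteq> {\<lambda>L. ereal (l L + c) | l c. linear (l :: 'v dual_space \<Rightarrow> real)}"
      and g: "g = (\<lambda>x. SUP \<phi>\<in>A. \<phi> x)"
      unfolding supcl_eq_SUP const_shifts_bidual_functions by blast
    show "g \<in> {f. (\<forall>L. f L \<noteq> -\<infinity>) \<and> convex_ereal f \<and> lower_semicontinuous euclidean_topology f}
        \<union> {\<lambda>_. -\<infinity>}"
    proof (cases "A = {}")
      case True
      then show ?thesis by (simp add: g bot_ereal_def)
    next
      case False
      then obtain \<phi> where \<phi>: "\<phi> \<in> A" by blast
      have "g L \<noteq> -\<infinity>" for L
      proof -
        have "\<phi> L \<le> g L"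
          unfolding g using \<phi> by (rule SUP_upper)
        moreover have "\<phi> L \<noteq> -\<infinity>"
          using A \<phi> by auto
        ultimately show ?thesis by auto
      qed
      moreover have "convex_ereal g"
        unfolding g
      proof (rule convex_ereal_SUP)
        fix \<psi> assume "\<psi> \<in> A"
        then obtain l c where l: "linear l" and \<psi>: "\<psi> = (\<lambda>L. ereal (l L + c))"
          using A by blast
        show "convex_ereal \<psi>"
          unfolding convex_ereal_def
        proof (intro allI impI)
          fix x y and u v :: real assume "u + v = 1"
          then have "c = u * c + v * c"
            by (metis distrib_right mult_1)
          then show "\<psi> (u *\<^sub>R x + v *\<^sub>R y) \<le> ereal u * \<psi> x + ereal v * \<psi> y"
            by (simp add: \<psi> linear_add[OF l] linear_scale[OF l] algebra_simps)
        qed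
      qed
      moreover have "lower_semicontinuous euclidean_topology g"
        unfolding g top
      proof (rule lower_semicontinuous_SUP)
        fix \<psi> assume "\<psi> \<in> A"
        then obtain l c where l: "linear l" and \<psi>: "\<psi> = (\<lambda>L. ereal (l L + c))"
          using A by blast
        show "lower_semicontinuous (coordinate_topology B) \<psi>"
          unfolding \<psi> by (intro lower_semicontinuous_continuous continuous_map_add
              continuous_map_linear[OF B l]) simp
      qed
      ultimately show ?thesis by blast
    qed
  next
    fix f :: "'v dual_space \<Rightarrow> ereal"
    assume "f \<in> {f. (\<forall>L. f L \<noteq> -\<infinity>) \<and> convex_ereal f \<and> lower_semicontinuous euclidean_topology f}
        \<union> {\<lambda>_. -\<infinity>}"
    then consider "f = (\<lambda>_. -\<infinity>)" | "\<And>L. f L \<noteq> -\<infinity>" "convex_ereal f"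
        "lower_semicontinuous (coordinate_topology B) f"
      by (auto simp: top)
    then show "f \<in> supcl bidual_functions"
    proof cases
      case 1
      then show ?thesis by (simp add: bottom_in_supcl)
    next
      case 2
      define A where "A = {\<phi> \<in> const_shifts bidual_functions. \<phi> \<le> f}"
      have "f x = (SUP \<phi>\<in>A. \<phi> x)" for x
      proof (rule antisym)
        show "(SUP \<phi>\<in>A. \<phi> x) \<le> f x"
          by (rule SUP_least) (auto simp: A_def le_fun_def)
        show "f x \<le> (SUP \<phi>\<in>A. \<phi> x)"
        \<comment> \<open>Approximation from below treats finite and infinite \<open>f x\<close>
          alike: only real \<open>s\<close> needs a minorant, as \<open>-\<infinity>\<close> is
          trivial and \<open>\<infinity>\<close> is never below \<open>f x\<close>.\<close>
        proof (rule dense_le)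
          fix s assume s: "s < f x"
          show "s \<le> (SUP \<phi>\<in>A. \<phi> x)"
          proof (cases s)
            case (real a)
            with s have "ereal a < f x" by simp
            from affine_minorant_at[OF B 2 this] obtain l c
              where lc: "linear l" "\<And>z. ereal (l z + c) \<le> f z" "a \<le> l x + c"
              by metis
            then have "(\<lambda>z. ereal (l z + c)) \<in> A"
              by (auto simp: A_def const_shifts_bidual_functions le_fun_def)
            then have "ereal (l x + c) \<le> (SUP \<phi>\<in>A. \<phi> x)"
              by (rule SUP_upper)
            with lc real show ?thesis
              by (metis ereal_less_eq(3) order_trans)
          qed (use s in auto)
        qed
      qed
      then have "f = (\<lambda>x. SUP \<phi>\<in>A. \<phi> x)" by blast
      then show ?thesis
        unfolding supcl_eq_SUP A_def by blast
    qed
  qed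
qed

theorem theorem6p7:
  assumes "finite_dimensional TYPE('m::group_add real_hom)"
  shows "supcl (hom_functions :: ('m \<Rightarrow> ereal) set) =
           {f \<circ> eval_at | f. f \<in> supcl (bidual_functions :: ('m real_hom dual_space \<Rightarrow> ereal) set)}
       \<and> {f \<circ> eval_at | f. f \<in> supcl (bidual_functions :: ('m real_hom dual_space \<Rightarrow> ereal) set)} =
           {f \<circ> eval_at | f :: 'm real_hom dual_space \<Rightarrow> ereal.
              (\<forall>L. f L \<noteq> -\<infinity>) \<and> convex_ereal f \<and> lower_semicontinuous euclidean_topology f}
           \<union> {\<lambda>_. -\<infinity>}"
proof
  show "supcl (hom_functions :: ('m \<Rightarrow> ereal) set) =
      {f \<circ> eval_at | f. f \<in> supcl (bidual_functions :: ('m real_hom dual_space \<Rightarrow> ereal) set)}"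
    unfolding hom_functions_eq by (rule supcl_comp)
  show "{f \<circ> eval_at | f. f \<in> supcl (bidual_functions :: ('m real_hom dual_space \<Rightarrow> ereal) set)} =
           {f \<circ> eval_at | f :: 'm real_hom dual_space \<Rightarrow> ereal.
              (\<forall>L. f L \<noteq> -\<infinity>) \<and> convex_ereal f \<and> lower_semicontinuous euclidean_topology f}
           \<union> {\<lambda>_. -\<infinity>}"
    \<comment> \<open>Composition with \<open>eval_at\<close> fixes the constant
      \<open>-\<infinity>\<close>, so the union carries over.\<close>
    unfolding supcl_bidual_functions[OF finite_dimensional_dual[OF assms]]
    by (auto simp: o_def)
qed

end
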